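(* Let $f:\mathbb{R}^n\to\mathbb{R}$ be differentiable and bounded from below, $f(x)\ge f^*$ for all $x\in\mathbb{R}^n$, and $L$-smooth with $L>0$, i.e. $\|\nabla f(x)-\nabla f(y)\|\le L\|x-y\|$ for all $x,y\in\mathbb{R}^n$. Suppose that for some $\mu>0$ $$\|\nabla f(x)\|^2\ge 2\mu\,(f(x)-f^* )\qquad\text{for all }x\in\mathbb{R}^n,$$ and that $$\alpha\in\left(0,\frac1L\right),\qquad \beta\in\left[0,\sqrt{(1-\alpha L)(1-\alpha\mu)}\,\right].$$ Let $x_0,x_1\in\mathbb{R}^n$ be arbitrary, let $$x_{k+1}=x_k-\alpha\nabla f(x_k)+\beta(x_k-x_{k-1}),\qquad k\ge1,$$ and let $$V_k=f(x_k)-f^*+\frac{1-\alpha L}{2\alpha}\|x_k-x_{k-1}\|^2,\qquad k\ge1.$$ Then, with $q=1-\alpha\mu<1$, the Lyapunov function converges linearly: $$V_{k+1}\le q^k V_1\qquad\text{for all }k\ge0.$$ If moreover $x_0=x_1$, then the objective function converges linearly: $$f(x_{k+1})-f^*\le q^k\,(f(x_0)-f^* )\qquad\text{for all }k\ge0.$$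
   Context: $\|\cdot\|$ is the Euclidean norm on $\mathbb{R}^n$. No convexity of $f$ is assumed. The square root in the range of $\beta$ is the real square root of a nonnegative number, so the hypothesis on $\beta$ includes $(1-\alpha L)(1-\alpha\mu)\ge0$. *)

theory Defs
  imports "HOL-Analysis.Analysis"
begin

end

theory Submission
  imports Defs
begin

text \<open>
  Write g for the gradient at the current iterate, m for the last displacement and
  d = - \<alpha> g + \<beta> m for the next one. The weight (1 - \<alpha> L) / (2 \<alpha>) in the Lyapunov function
  is exactly what the quadratic term of the descent lemma (\<open>descent_lemma\<close>) lacks to complete a
  square: (L / 2) |d|^2 + (1 - \<alpha> L) / (2 \<alpha>) |d|^2 = |d|^2 / (2 \<alpha>), and

  g . d + |d|^2 / (2 \<alpha>) = |d + \<alpha> g|^2 / (2 \<alpha>) - (\<alpha> / 2) |g|^2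
    = (\<beta>^2 / (2 \<alpha>)) |m|^2 - (\<alpha> / 2) |g|^2.

  The gradient term contracts the objective gap by the factor 1 - \<alpha> \<mu> through the
  Polyak-Lojasiewicz inequality, and the bound on \<beta> makes the momentum term contract by the same
  factor. So each step multiplies the Lyapunov function by at most 1 - \<alpha> \<mu>
  (\<open>heavy_ball_contraction\<close>). This factor is nonnegative because the radicand is nonnegative while
  1 - \<alpha> L > 0, and therefore the one-step bounds can be iterated. When the two starting points agree,
  the initial Lyapunov value is the initial objective gap.
\<close>

text \<open>
  Subtract the quadratic upper model from the function along the segment from y to y + d. By the
  Cauchy-Schwarz inequality and the Lipschitz bound, the difference has a nonpositive derivative
  on [0, 1]; it is therefore no larger at the end than at the start.
\<close>

lemma descent_lemma:
  fixes f :: "'a::real_inner \<Rightarrow> real" and grad :: "'a \<Rightarrow> 'a"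
  assumes diff: "\<And>y. GDERIV f y :> grad y"
    and smooth: "\<And>y z. norm (grad y - grad z) \<le> L * norm (y - z)"
  shows "f (y + d) \<le> f y + inner (grad y) d + L / 2 * (norm d)\<^sup>2"
proof -
  define \<phi> where
    "\<phi> t = f (y + t *\<^sub>R d) - t * inner (grad y) d - L / 2 * t\<^sup>2 * (norm d)\<^sup>2" for t :: real
  have deriv: "(\<phi> has_real_derivative
      (inner (grad (y + t *\<^sub>R d) - grad y) d - L * t * (norm d)\<^sup>2)) (at t)" for t
  proof -
    have f': "(f has_derivative (\<lambda>h. inner h (grad (y + t *\<^sub>R d)))) (at (y + t *\<^sub>R d))"
      using diff by (simp add: gderiv_def)
    have line: "((\<lambda>t. y + t *\<^sub>R d) has_derivative (\<lambda>h. h *\<^sub>R d)) (at t)"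
      by (auto intro!: derivative_eq_intros)
    have "((\<lambda>t. f (y + t *\<^sub>R d)) has_derivative
        (\<lambda>h. inner (h *\<^sub>R d) (grad (y + t *\<^sub>R d)))) (at t)"
      by (rule has_derivative_compose[OF line f'])
    then have along: "((\<lambda>t. f (y + t *\<^sub>R d)) has_real_derivative
        inner (grad (y + t *\<^sub>R d)) d) (at t)"
      by (simp add: has_field_derivative_def inner_commute mult_commute_abs)
    show ?thesis
      unfolding \<phi>_def
      by (auto intro!: derivative_eq_intros along simp: inner_diff_left)
  qed
  have "\<phi> 1 \<le> \<phi> 0"
  proof (rule DERIV_nonpos_imp_nonincreasing[of 0 1 \<phi>])
    fix t :: real
    assume "0 \<le> t" "t \<le> 1"
    have "inner (grad (y + t *\<^sub>R d) - grad y) d \<le> norm (grad (y + t *\<^sub>R d) - grad y) * norm d"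
      by (rule norm_cauchy_schwarz)
    also have "\<dots> \<le> (L * norm (t *\<^sub>R d)) * norm d"
      using smooth[of "y + t *\<^sub>R d" y] by (intro mult_right_mono) auto
    also have "\<dots> = L * t * (norm d)\<^sup>2"
      using \<open>0 \<le> t\<close> by (simp add: power2_eq_square)
    finally show "\<exists>D. (\<phi> has_real_derivative D) (at t) \<and> D \<le> 0"
      using deriv[of t] by (intro exI conjI) auto
  qed simp
  then show ?thesis
    by (simp add: \<phi>_def)
qed

text \<open>
  Completing the square about - \<alpha> g separates the two contributions, because d + \<alpha> g = \<beta> m: no
  mixed inner product of g and m survives. The objective gap and the momentum term can then be
  contracted independently. Both inequalities on f enter only at the current point, so g may be any
  vector satisfying them there.
\<close>

lemma heavy_ball_contraction:
  fixes f :: "'a::real_inner \<Rightarrow> real" and g m y d :: 'a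
  assumes d: "d = \<beta> *\<^sub>R m - \<alpha> *\<^sub>R g"
    and descent: "f (y + d) \<le> f y + inner g d + L / 2 * (norm d)\<^sup>2"
    and PL: "(norm g)\<^sup>2 \<ge> 2 * \<mu> * (f y - F)"
    and \<alpha>: "\<alpha> > 0"
    and \<beta>: "\<beta>\<^sup>2 \<le> (1 - \<alpha> * L) * (1 - \<alpha> * \<mu>)"
  shows "f (y + d) - F + (1 - \<alpha> * L) / (2 * \<alpha>) * (norm d)\<^sup>2
    \<le> (1 - \<alpha> * \<mu>) * (f y - F + (1 - \<alpha> * L) / (2 * \<alpha>) * (norm m)\<^sup>2)"
proof -
  have square: "inner g d + (norm d)\<^sup>2 / (2 * \<alpha>)
      = \<beta>\<^sup>2 / (2 * \<alpha>) * (norm m)\<^sup>2 - \<alpha> / 2 * (norm g)\<^sup>2"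
  proof -
    have "(norm (d + \<alpha> *\<^sub>R g))\<^sup>2 = (norm d)\<^sup>2 + 2 * \<alpha> * inner g d + \<alpha>\<^sup>2 * (norm g)\<^sup>2"
      unfolding power2_norm_eq_inner
      by (simp add: inner_add_left inner_add_right inner_commute power2_eq_square)
    moreover have "(norm (d + \<alpha> *\<^sub>R g))\<^sup>2 = \<beta>\<^sup>2 * (norm m)\<^sup>2"
      by (simp add: d power_mult_distrib)
    ultimately show ?thesis
      using \<alpha> by (simp add: field_simps power2_eq_square)
  qed
  have "f (y + d) - F + (1 - \<alpha> * L) / (2 * \<alpha>) * (norm d)\<^sup>2
      \<le> f y - F + inner g d + L / 2 * (norm d)\<^sup>2 + (1 - \<alpha> * L) / (2 * \<alpha>) * (norm d)\<^sup>2"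
    using descent by simp
  also have "\<dots> = f y - F + (inner g d + (norm d)\<^sup>2 / (2 * \<alpha>))"
    using \<alpha> by (simp add: field_simps)
  also have "\<dots> = f y - F - \<alpha> / 2 * (norm g)\<^sup>2 + \<beta>\<^sup>2 / (2 * \<alpha>) * (norm m)\<^sup>2"
    using square by simp
  also have "\<dots> \<le> (1 - \<alpha> * \<mu>) * (f y - F)
      + (1 - \<alpha> * L) * (1 - \<alpha> * \<mu>) / (2 * \<alpha>) * (norm m)\<^sup>2"
  proof (rule add_mono)
    have "\<alpha> / 2 * (2 * \<mu> * (f y - F)) \<le> \<alpha> / 2 * (norm g)\<^sup>2"
      using PL \<alpha> by (intro mult_left_mono) auto
    then show "f y - F - \<alpha> / 2 * (norm g)\<^sup>2 \<le> (1 - \<alpha> * \<mu>) * (f y - F)"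
      by (simp add: algebra_simps)
    show "\<beta>\<^sup>2 / (2 * \<alpha>) * (norm m)\<^sup>2
        \<le> (1 - \<alpha> * L) * (1 - \<alpha> * \<mu>) / (2 * \<alpha>) * (norm m)\<^sup>2"
      using \<beta> \<alpha> by (intro mult_right_mono divide_right_mono) auto
  qed
  also have "\<dots> = (1 - \<alpha> * \<mu>) * (f y - F + (1 - \<alpha> * L) / (2 * \<alpha>) * (norm m)\<^sup>2)"
    by (simp add: algebra_simps)
  finally show ?thesis .
qed

theorem theorem3:
  fixes f :: "real ^ 'n \<Rightarrow> real"
    and grad :: "real ^ 'n \<Rightarrow> real ^ 'n"
    and fstar L \<mu> \<alpha> \<beta> q :: real
    and x :: "nat \<Rightarrow> real ^ 'n"
    and V :: "nat \<Rightarrow> real"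
  assumes diff: "\<And>y. GDERIV f y :> grad y"
    and lower: "\<And>y. f y \<ge> fstar"
    and L_pos: "L > 0"
    and smooth: "\<And>y z. norm (grad y - grad z) \<le> L * norm (y - z)"
    and mu_pos: "\<mu> > 0"
    and PL: "\<And>y. (norm (grad y))\<^sup>2 \<ge> 2 * \<mu> * (f y - fstar)"
    and alpha: "\<alpha> \<in> {0<..<1 / L}"
    and radicand_nonneg: "(1 - \<alpha> * L) * (1 - \<alpha> * \<mu>) \<ge> 0"
    and beta: "\<beta> \<in> {0..sqrt ((1 - \<alpha> * L) * (1 - \<alpha> * \<mu>))}"
    and step: "\<And>k. k \<ge> 1 \<Longrightarrow>
      x (k + 1) = x k - \<alpha> *\<^sub>R grad (x k) + \<beta> *\<^sub>R (x k - x (k - 1))"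
    and V: "\<And>k. k \<ge> 1 \<Longrightarrow>
      V k = f (x k) - fstar + (1 - \<alpha> * L) / (2 * \<alpha>) * (norm (x k - x (k - 1)))\<^sup>2"
    and q: "q = 1 - \<alpha> * \<mu>"
  shows "q < 1 \<and>
    (\<forall>k. V (k + 1) \<le> q ^ k * V 1) \<and>
    (x 0 = x 1 \<longrightarrow> (\<forall>k. f (x (k + 1)) - fstar \<le> q ^ k * (f (x 0) - fstar)))"
proof -
  have \<alpha>_pos: "\<alpha> > 0" and \<alpha>L: "1 - \<alpha> * L > 0"
    using alpha L_pos by (auto simp: field_simps)
  have q_nonneg: "q \<ge> 0"
    using radicand_nonneg \<alpha>L by (simp add: q zero_le_mult_iff)
  have "\<beta>\<^sup>2 \<le> (sqrt ((1 - \<alpha> * L) * (1 - \<alpha> * \<mu>)))\<^sup>2"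
    using beta by (intro power_mono) auto
  then have \<beta>_sq: "\<beta>\<^sup>2 \<le> (1 - \<alpha> * L) * (1 - \<alpha> * \<mu>)"
    using radicand_nonneg by simp
  have contraction: "V (k + 1) \<le> q * V k" if "k \<ge> 1" for k
  proof -
    have d: "x (k + 1) - x k = \<beta> *\<^sub>R (x k - x (k - 1)) - \<alpha> *\<^sub>R grad (x k)"
      using step[OF that] by simp
    show ?thesis
      using heavy_ball_contraction[where f = f and F = fstar,
          OF d descent_lemma[OF diff smooth] PL \<alpha>_pos \<beta>_sq]
      using V[OF that] V[of "k + 1"] by (simp add: q)
  qed
  have linear: "V (k + 1) \<le> q ^ k * V 1" for k
  proof (induction k)
    case 0
    show ?case by simp
  next
    case (Suc k)
    have "V (Suc k + 1) \<le> q * V (k + 1)"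
      using contraction[of "k + 1"] by simp
    also have "\<dots> \<le> q * (q ^ k * V 1)"
      using Suc q_nonneg by (rule mult_left_mono)
    finally show ?case
      by (simp add: mult.assoc)
  qed
  have "f (x (k + 1)) - fstar \<le> q ^ k * (f (x 0) - fstar)" if start: "x 0 = x 1" for k
  proof -
    have "0 \<le> (1 - \<alpha> * L) / (2 * \<alpha>) * (norm (x (k + 1) - x k))\<^sup>2"
      using \<alpha>L \<alpha>_pos by simp
    then have "f (x (k + 1)) - fstar \<le> V (k + 1)"
      using V[of "k + 1"] by simp
    also have "\<dots> \<le> q ^ k * V 1"
      by (rule linear)
    also have "V 1 = f (x 0) - fstar"
      using V[of 1] start by simp
    finally show ?thesis .
  qed
  moreover have "q < 1"
    using \<alpha>_pos mu_pos by (simp add: q)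
  ultimately show ?thesis
    using linear by blast
qed

end
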